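(* Let $G=(V,E)$ be a finite directed graph, let $\varepsilon\in(0,1)$, and let $K\subseteq V$ be coherent. Then there exists a reset vector $r$ on $G$ such that $R_{\min}(G,K,\varepsilon)=\mathrm{PR}(G,r,\varepsilon)$.
   Context: Every vertex of a graph with no out-edges is assumed to carry a self-loop; $d_{out}(u)$ is the out-degree of $u$. A ranking vector (or reset vector) on $G$ is a function $x:V\to[0,1]$ with $\sum_{v}x[v]=1$. For a reset vector $r$ and $\varepsilon\in(0,1)$, $\mathrm{PR}(G,r,\varepsilon)$ is the unique stationary distribution of the Markov chain on $V$ with transition matrix $(1-\varepsilon)M+\varepsilon R$, where $M[u,v]=1/d_{out}(u)$ if $(u,v)\in E$ and $0$ otherwise, and $R[u,v]=r[v]$. For $c\in V$, $\mathrm{PR}(G,c,\varepsilon)$ denotes this with $r$ the point mass at $c$. A set $K\subseteq V$ is coherent if it is non-empty and there is a vertex $v\in V$ such that every vertex of $K$ has a directed path to $v$. For coherent $K$, $R_{\min}(G,K,\varepsilon)$ is the vector $y/\|y\|_1$ where $y[v]=\min\{\mathrm{PR}(G,c,\varepsilon)[v]: c\in K\}$ (coherence guarantees $y\neq 0$). *)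

theory Defs
  imports Complex_Main "HOL-Library.FuncSet" "Graph_Theory.Pair_Digraph"
begin

text \<open>Vectors indexed by the vertex set \<open>V\<close> are extensional functions on \<open>V\<close>, so that HOL
  equality of two vectors is equality on \<open>V\<close>.\<close>

definition distribution_on :: "'a set \<Rightarrow> ('a \<Rightarrow> real) \<Rightarrow> bool" where
  "distribution_on V x \<longleftrightarrow> x \<in> V \<rightarrow>\<^sub>E {0..1} \<and> (\<Sum>v\<in>V. x v) = 1"

definition stationary_distribution :: "'a set \<Rightarrow> ('a \<Rightarrow> 'a \<Rightarrow> real) \<Rightarrow> ('a \<Rightarrow> real) \<Rightarrow> bool" where
  "stationary_distribution V P x \<longleftrightarrow>
     distribution_on V x \<and> (\<forall>v\<in>V. (\<Sum>u\<in>V. x u * P u v) = x v)"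

abbreviation ranking_vector :: "'a pair_pre_digraph \<Rightarrow> ('a \<Rightarrow> real) \<Rightarrow> bool" where
  "ranking_vector G x \<equiv> distribution_on (pverts G) x"

definition walk_matrix :: "'a pair_pre_digraph \<Rightarrow> 'a \<Rightarrow> 'a \<Rightarrow> real" where
  "walk_matrix G u v = (if (u, v) \<in> parcs G then 1 / real (out_degree (with_proj G) u) else 0)"

definition reset_matrix :: "('a \<Rightarrow> real) \<Rightarrow> 'a \<Rightarrow> 'a \<Rightarrow> real" where
  "reset_matrix r u v = r v"

definition PR :: "'a pair_pre_digraph \<Rightarrow> ('a \<Rightarrow> real) \<Rightarrow> real \<Rightarrow> 'a \<Rightarrow> real" where
  "PR G r \<epsilon> = (THE x. stationary_distribution (pverts G)
     (\<lambda>u v. (1 - \<epsilon>) * walk_matrix G u v + \<epsilon> * reset_matrix r u v) x)"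

definition point_mass :: "'a pair_pre_digraph \<Rightarrow> 'a \<Rightarrow> 'a \<Rightarrow> real" where
  "point_mass G c = (\<lambda>v\<in>pverts G. if v = c then 1 else 0)"

definition coherent :: "'a pair_pre_digraph \<Rightarrow> 'a set \<Rightarrow> bool" where
  "coherent G K \<longleftrightarrow> K \<noteq> {} \<and> K \<subseteq> pverts G \<and>
     (\<exists>v\<in>pverts G. \<forall>u\<in>K. reachable (with_proj G) u v)"

definition R_min :: "'a pair_pre_digraph \<Rightarrow> 'a set \<Rightarrow> real \<Rightarrow> 'a \<Rightarrow> real" where
  "R_min G K \<epsilon> =
     (let y = (\<lambda>v. Min ((\<lambda>c. PR G (point_mass G c) \<epsilon> v) ` K))
      in (\<lambda>v\<in>pverts G. y v / (\<Sum>w\<in>pverts G. \<bar>y w\<bar>)))"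

end

theory Submission
  imports Defs
begin

text \<open>
  Write \<open>a = 1 - \<epsilon>\<close>. A probability vector \<open>x\<close> equals \<open>PR G r \<epsilon>\<close> iff
  \<open>x = a x M + \<epsilon> r\<close>; existence is the geometric series \<open>\<Sum>k. \<epsilon> a\<^sup>k r M\<^sup>k\<close> and uniqueness holds
  because \<open>x \<mapsto> a x M\<close> contracts the 1-norm. Hence a probability vector \<open>z\<close> is a PageRank vector
  for some reset vector iff \<open>a z M \<le> z\<close> pointwise: the reset vector is then \<open>(z - a z M) / \<epsilon>\<close>.
  This condition holds for each \<open>PR G c \<epsilon>\<close> and is preserved by pointwise minima and by positive
  scaling. Coherence makes the minimum positive at a vertex reachable from all of \<open>K\<close>.
\<close>

section \<open>PageRank equation for a stochastic matrix on a finite set\<close>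

locale stochastic_matrix =
  fixes V :: "'a set" and M :: "'a \<Rightarrow> 'a \<Rightarrow> real"
  assumes finite_V: "finite V"
    and M_nonneg: "\<And>u v. 0 \<le> M u v"
    and M_row_sum: "\<And>u. u \<in> V \<Longrightarrow> (\<Sum>v\<in>V. M u v) = 1"
begin

text \<open>Conservation of mass: after swapping the sums, each \<open>x u\<close> is weighted by a
  row sum of \<open>M\<close>, which is 1.\<close>

lemma sum_vector_mult: "(\<Sum>v\<in>V. \<Sum>u\<in>V. x u * M u v) = (\<Sum>u\<in>V. x u)"
proof -
  have "(\<Sum>v\<in>V. \<Sum>u\<in>V. x u * M u v) = (\<Sum>u\<in>V. x u * (\<Sum>v\<in>V. M u v))"
    by (subst sum.swap) (simp add: sum_distrib_left)
  then show ?thesis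
    by (simp add: M_row_sum)
qed

lemma distribution_onI:
  assumes "x \<in> extensional V" "\<And>v. v \<in> V \<Longrightarrow> 0 \<le> x v" "(\<Sum>v\<in>V. x v) = 1"
  shows "distribution_on V x"
proof -
  have "x v \<le> 1" if "v \<in> V" for v
    using member_le_sum[of v V x] that assms finite_V by auto
  then show ?thesis
    using assms by (auto simp: distribution_on_def PiE_def)
qed

text \<open>All rows of the reset matrix equal \<open>r\<close>, so total mass 1 turns its
  contribution into the constant \<open>\<epsilon> * r v\<close>. Stationarity thus becomes an
  affine equation in \<open>x\<close>.\<close>

lemma stationary_distribution_iff:
  assumes "distribution_on V x"
  shows "stationary_distribution V (\<lambda>u v. (1 - \<epsilon>) * M u v + \<epsilon> * reset_matrix r u v) x \<longleftrightarrow>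
    (\<forall>v\<in>V. x v = (1 - \<epsilon>) * (\<Sum>u\<in>V. x u * M u v) + \<epsilon> * r v)"
proof -
  have "(\<Sum>u\<in>V. x u * ((1 - \<epsilon>) * M u v + \<epsilon> * reset_matrix r u v)) =
      (1 - \<epsilon>) * (\<Sum>u\<in>V. x u * M u v) + (\<Sum>u\<in>V. x u) * (\<epsilon> * r v)" for v
    by (simp add: reset_matrix_def distrib_left sum.distrib sum_distrib_left sum_distrib_right
        mult.left_commute)
  moreover have "(\<Sum>u\<in>V. x u) = 1"
    using assms by (simp add: distribution_on_def)
  ultimately show ?thesis
    using assms by (auto simp: stationary_distribution_def)
qed

lemma pagerank_equation_unique:
  assumes "0 < \<epsilon>" "\<epsilon> < 1"
    and x: "\<And>v. v \<in> V \<Longrightarrow> x v = (1 - \<epsilon>) * (\<Sum>u\<in>V. x u * M u v) + b v"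
    and y: "\<And>v. v \<in> V \<Longrightarrow> y v = (1 - \<epsilon>) * (\<Sum>u\<in>V. y u * M u v) + b v"
    and "v \<in> V"
  shows "x v = y v"
proof -
  define d where "d v = x v - y v" for v
  \<comment> \<open>The term \<open>b\<close> cancels in the difference. Summed over
    \<open>V\<close>, this bound and conservation of mass say that the 1-norm of \<open>d\<close> is
    at most \<open>1 - \<epsilon>\<close> times itself, hence 0.\<close>
  have "\<bar>d v\<bar> \<le> (1 - \<epsilon>) * (\<Sum>u\<in>V. \<bar>d u\<bar> * M u v)" if "v \<in> V" for v
  proof -
    have "d v = (1 - \<epsilon>) * (\<Sum>u\<in>V. d u * M u v)"
      using x[OF that] y[OF that]
      by (simp add: d_def left_diff_distrib sum_subtractf right_diff_distrib)
    moreover have "\<bar>\<Sum>u\<in>V. d u * M u v\<bar> \<le> (\<Sum>u\<in>V. \<bar>d u\<bar> * M u v)"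
      using sum_abs[of "\<lambda>u. d u * M u v" V] by (simp add: abs_mult M_nonneg)
    ultimately show ?thesis
      using \<open>\<epsilon> < 1\<close> by (simp add: abs_mult)
  qed
  then have "(\<Sum>v\<in>V. \<bar>d v\<bar>) \<le> (\<Sum>v\<in>V. (1 - \<epsilon>) * (\<Sum>u\<in>V. \<bar>d u\<bar> * M u v))"
    by (rule sum_mono)
  also have "\<dots> = (1 - \<epsilon>) * (\<Sum>v\<in>V. \<bar>d v\<bar>)"
    by (simp add: sum_distrib_left[symmetric] sum_vector_mult)
  finally have "\<epsilon> * (\<Sum>v\<in>V. \<bar>d v\<bar>) \<le> 0"
    by (simp add: algebra_simps)
  then have "(\<Sum>v\<in>V. \<bar>d v\<bar>) \<le> 0"
    using \<open>0 < \<epsilon>\<close> by (simp add: mult_le_0_iff)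
  then have "(\<Sum>v\<in>V. \<bar>d v\<bar>) = 0"
    by (simp add: antisym sum_nonneg)
  then show ?thesis
    using \<open>v \<in> V\<close> finite_V by (simp add: sum_nonneg_eq_0_iff d_def)
qed

lemma pagerank_equation_solution:
  assumes "0 < \<epsilon>" "\<epsilon> < 1" and r: "distribution_on V r"
  obtains x where "distribution_on V x"
    "\<And>v. v \<in> V \<Longrightarrow> x v = (1 - \<epsilon>) * (\<Sum>u\<in>V. x u * M u v) + \<epsilon> * r v"
proof -
  \<comment> \<open>\<open>p k\<close> is the law of the walk after \<open>k\<close> steps when
    started from \<open>r\<close>.\<close>
  define p where "p = rec_nat r (\<lambda>_ q v. \<Sum>u\<in>V. q u * M u v)"
  have p_0: "p 0 = r" and p_Suc: "p (Suc k) v = (\<Sum>u\<in>V. p k u * M u v)" for k v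
    by (simp_all add: p_def)
  have p_nonneg: "0 \<le> p k v" if "v \<in> V" for k v
    using that
  proof (induction k arbitrary: v)
    case 0
    then show ?case using r by (auto simp: p_0 distribution_on_def PiE_def)
  next
    case (Suc k)
    then show ?case by (auto simp: p_Suc intro!: sum_nonneg mult_nonneg_nonneg M_nonneg)
  qed
  have p_sum: "(\<Sum>v\<in>V. p k v) = 1" for k
    by (induction k) (use r in \<open>simp_all add: p_0 p_Suc sum_vector_mult distribution_on_def\<close>)
  have p_le_1: "p k v \<le> 1" if "v \<in> V" for k v
    using member_le_sum[of v V "p k"] that p_nonneg p_sum[of k] finite_V by auto
  \<comment> \<open>The weights \<open>\<epsilon> * (1 - \<epsilon>) ^ k\<close> form a geometric
    law, so the sum of \<open>t k\<close> over \<open>k\<close> is the law of the walk stopped at an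
    independent geometric time.\<close>
  define t where "t k v = \<epsilon> * (1 - \<epsilon>) ^ k * p k v" for k v
  have geom: "(\<lambda>k. \<epsilon> * (1 - \<epsilon>) ^ k) sums 1"
    using sums_mult[OF geometric_sums[of "1 - \<epsilon>"], of \<epsilon>] assms by simp
  have summable_t: "summable (\<lambda>k. t k v)" if "v \<in> V" for v
  proof (rule summable_comparison_test)
    show "\<exists>N. \<forall>k\<ge>N. norm (t k v) \<le> \<epsilon> * (1 - \<epsilon>) ^ k"
      using p_nonneg[OF that] p_le_1[OF that] assms
      by (auto simp: t_def abs_mult mult_left_le)
    show "summable (\<lambda>k. \<epsilon> * (1 - \<epsilon>) ^ k)"
      using geom by (rule sums_summable)
  qed
  define x where "x = (\<lambda>v\<in>V. \<Sum>k. t k v)"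
  have x_sums: "(\<lambda>k. t k v) sums x v" if "v \<in> V" for v
    using summable_sums[OF summable_t[OF that]] that by (simp add: x_def)
  have "distribution_on V x"
  proof (rule distribution_onI)
    show "x \<in> extensional V"
      by (simp add: x_def)
    show "0 \<le> x v" if "v \<in> V" for v
      using suminf_nonneg[OF summable_t[OF that]] p_nonneg[OF that] assms that
      by (simp add: x_def t_def)
    have "(\<lambda>k. \<Sum>v\<in>V. t k v) sums (\<Sum>v\<in>V. x v)"
      by (rule sums_sum) (rule x_sums)
    moreover have "(\<Sum>v\<in>V. t k v) = \<epsilon> * (1 - \<epsilon>) ^ k" for k
      by (simp add: t_def sum_distrib_left[symmetric] p_sum)
    ultimately show "(\<Sum>v\<in>V. x v) = 1"
      using geom by (simp add: sums_unique2)
  qed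
  moreover have "x v = (1 - \<epsilon>) * (\<Sum>u\<in>V. x u * M u v) + \<epsilon> * r v" if "v \<in> V" for v
  proof -
    \<comment> \<open>Applying \<open>(1 - \<epsilon>) M\<close> to the series shifts its index by
      one. The missing term \<open>t 0 v\<close> is exactly the reset term
      \<open>\<epsilon> * r v\<close>.\<close>
    have "(\<lambda>k. (1 - \<epsilon>) * (\<Sum>u\<in>V. t k u * M u v)) sums ((1 - \<epsilon>) * (\<Sum>u\<in>V. x u * M u v))"
      by (intro sums_mult sums_sum sums_mult2 x_sums)
    moreover have "(1 - \<epsilon>) * (\<Sum>u\<in>V. t k u * M u v) = t (Suc k) v" for k
      by (simp add: t_def p_Suc sum_distrib_left mult_ac)
    ultimately have "(\<lambda>k. t k v) sums ((1 - \<epsilon>) * (\<Sum>u\<in>V. x u * M u v) + t 0 v)"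
      by (intro sums_Suc) simp
    then show ?thesis
      using x_sums[OF that] by (simp add: sums_unique2 t_def p_0)
  qed
  ultimately show thesis
    by (rule that)
qed

lemma ex1_stationary_distribution:
  assumes "0 < \<epsilon>" "\<epsilon> < 1" "distribution_on V r"
  shows "\<exists>!x. stationary_distribution V (\<lambda>u v. (1 - \<epsilon>) * M u v + \<epsilon> * reset_matrix r u v) x"
    (is "\<exists>!x. ?stat x")
proof (rule ex_ex1I)
  show "\<exists>x. ?stat x"
  proof -
    obtain x where "distribution_on V x"
      and "\<And>v. v \<in> V \<Longrightarrow> x v = (1 - \<epsilon>) * (\<Sum>u\<in>V. x u * M u v) + \<epsilon> * r v"
      using pagerank_equation_solution[OF assms] by blast
    then have "?stat x"
      by (subst stationary_distribution_iff) auto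
    then show ?thesis by blast
  qed
next
  fix x y
  assume "?stat x" "?stat y"
  moreover from this have dist: "distribution_on V x" "distribution_on V y"
    by (auto simp: stationary_distribution_def)
  ultimately have "x v = y v" if "v \<in> V" for v
    using pagerank_equation_unique[OF assms(1,2), of x "\<lambda>v. \<epsilon> * r v" y v] that
    by (simp add: stationary_distribution_iff)
  \<comment> \<open>Distributions are extensional, so agreement on \<open>V\<close> is equality of
    functions.\<close>
  with dist show "x = y"
    by (auto simp: distribution_on_def PiE_def intro: extensionalityI)
qed

lemma subinvariant_imp_reset:
  assumes "0 < \<epsilon>" and z: "distribution_on V z"
    and sub: "\<And>v. v \<in> V \<Longrightarrow> (1 - \<epsilon>) * (\<Sum>u\<in>V. z u * M u v) \<le> z v"
  obtains r where "distribution_on V r"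
    "stationary_distribution V (\<lambda>u v. (1 - \<epsilon>) * M u v + \<epsilon> * reset_matrix r u v) z"
proof
  define r where "r = (\<lambda>v\<in>V. (z v - (1 - \<epsilon>) * (\<Sum>u\<in>V. z u * M u v)) / \<epsilon>)"
  show "distribution_on V r"
  proof (rule distribution_onI)
    \<comment> \<open>By conservation of mass the numerator has total
      \<open>1 - (1 - \<epsilon>) = \<epsilon>\<close>. Nonnegativity of \<open>r\<close> is the
      hypothesis \<open>sub\<close>.\<close>
    have "(\<Sum>v\<in>V. r v) = ((\<Sum>v\<in>V. z v) - (1 - \<epsilon>) * (\<Sum>v\<in>V. z v)) / \<epsilon>"
      by (simp add: r_def sum_divide_distrib[symmetric] sum_subtractf
          sum_distrib_left[symmetric] sum_vector_mult)
    then show "(\<Sum>v\<in>V. r v) = 1"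
      using z \<open>0 < \<epsilon>\<close> by (simp add: distribution_on_def)
  qed (use sub \<open>0 < \<epsilon>\<close> in \<open>auto simp: r_def\<close>)
  show "stationary_distribution V (\<lambda>u v. (1 - \<epsilon>) * M u v + \<epsilon> * reset_matrix r u v) z"
    using \<open>0 < \<epsilon>\<close> by (simp add: stationary_distribution_iff[OF z] r_def)
qed

end

section \<open>The walk matrix of a graph and its PageRank vectors\<close>

lemma stochastic_walk_matrix:
  assumes "pair_fin_digraph G"
    and pos: "\<And>u. u \<in> pverts G \<Longrightarrow> out_degree (with_proj G) u > 0"
  shows "stochastic_matrix (pverts G) (walk_matrix G)"
proof
  interpret pair_fin_digraph G by fact
  show "finite (pverts G)"
    by simp
  show "0 \<le> walk_matrix G u v" for u v
    by (simp add: walk_matrix_def)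
  fix u assume u: "u \<in> pverts G"
  \<comment> \<open>Arcs are pairs of vertices, so the out-degree counts out-neighbours, which are
    the nonzero entries of the row.\<close>
  have "out_arcs (with_proj G) u = Pair u ` {v \<in> pverts G. (u, v) \<in> parcs G}"
    using in_arcsD2 by (auto simp: out_arcs_def)
  then have deg: "out_degree (with_proj G) u = card {v \<in> pverts G. (u, v) \<in> parcs G}"
    by (simp add: out_degree_def card_image inj_on_def)
  have "(\<Sum>v\<in>pverts G. walk_matrix G u v) =
      (\<Sum>v | v \<in> pverts G \<and> (u, v) \<in> parcs G. 1 / real (out_degree (with_proj G) u))"
    unfolding walk_matrix_def by (rule sum.inter_filter[symmetric]) simp
  also have "\<dots> = 1"
    \<comment> \<open>The self-loop convention enters here through \<open>pos\<close>: at a vertex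
      of out-degree 0 the row would sum to 0.\<close>
    using pos[OF u] by (simp add: deg card_gt_0_iff)
  finally show "(\<Sum>v\<in>pverts G. walk_matrix G u v) = 1" .
qed

lemma distribution_on_point_mass:
  assumes "finite (pverts G)" "c \<in> pverts G"
  shows "distribution_on (pverts G) (point_mass G c)"
  using assms by (auto simp: distribution_on_def point_mass_def)

lemma stationary_PR:
  assumes "stochastic_matrix (pverts G) (walk_matrix G)"
    and "0 < \<epsilon>" "\<epsilon> < 1" "ranking_vector G r"
  shows "stationary_distribution (pverts G)
    (\<lambda>u v. (1 - \<epsilon>) * walk_matrix G u v + \<epsilon> * reset_matrix r u v) (PR G r \<epsilon>)"
  unfolding PR_def using stochastic_matrix.ex1_stationary_distribution[OF assms] by (rule theI')

lemma PR_eqI: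
  assumes "stochastic_matrix (pverts G) (walk_matrix G)"
    and "0 < \<epsilon>" "\<epsilon> < 1" "ranking_vector G r"
    and "stationary_distribution (pverts G)
      (\<lambda>u v. (1 - \<epsilon>) * walk_matrix G u v + \<epsilon> * reset_matrix r u v) x"
  shows "PR G r \<epsilon> = x"
  unfolding PR_def
  using the1_equality[OF stochastic_matrix.ex1_stationary_distribution[OF assms(1-4)]] assms(5)
  by simp

section \<open>The normalized minimum of PageRank vectors\<close>

theorem theorem8:
  fixes G :: "'a pair_pre_digraph" and K :: "'a set" and \<epsilon> :: real
  assumes "pair_fin_digraph G"
    and "\<And>u. u \<in> pverts G \<Longrightarrow> out_degree (with_proj G) u > 0"
    and "0 < \<epsilon>" and "\<epsilon> < 1"
    and "coherent G K"
  shows "\<exists>r. ranking_vector G r \<and> R_min G K \<epsilon> = PR G r \<epsilon>"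
proof -
  interpret pair_fin_digraph G by fact
  have stoch: "stochastic_matrix (pverts G) (walk_matrix G)"
    using assms(1,2) by (rule stochastic_walk_matrix)
  interpret W: stochastic_matrix "pverts G" "walk_matrix G" by fact
  let ?V = "pverts G" and ?M = "walk_matrix G"
  define P where "P c = PR G (point_mass G c) \<epsilon>" for c
  define y where "y v = Min ((\<lambda>c. P c v) ` K)" for v
  define s where "s = (\<Sum>v\<in>?V. y v)"
  obtain t where K: "K \<noteq> {}" "K \<subseteq> ?V" and t: "t \<in> ?V"
    and reach: "\<And>c. c \<in> K \<Longrightarrow> reachable (with_proj G) c t"
    using assms(5) by (auto simp: coherent_def)
  have "finite K"
    using K by (auto intro: finite_subset)
  have P_stat: "stationary_distribution ?V
      (\<lambda>u v. (1 - \<epsilon>) * ?M u v + \<epsilon> * reset_matrix (point_mass G c) u v) (P c)" if "c \<in> K" for c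
    unfolding P_def using that K assms(3,4)
    by (intro stationary_PR stoch distribution_on_point_mass) auto
  then have P_dist: "distribution_on ?V (P c)" if "c \<in> K" for c
    using that by (simp add: stationary_distribution_def)
  have P_eq: "P c v = (1 - \<epsilon>) * (\<Sum>u\<in>?V. P c u * ?M u v) + (if v = c then \<epsilon> else 0)"
    if "c \<in> K" "v \<in> ?V" for c v
    using P_stat[OF that(1)] that(2)
    unfolding W.stationary_distribution_iff[OF P_dist[OF that(1)]]
    by (auto simp: point_mass_def)
  have P_nonneg: "0 \<le> P c v" if "c \<in> K" "v \<in> ?V" for c v
    using P_dist[OF that(1)] that(2) by (auto simp: distribution_on_def PiE_def)
  have y_le: "y v \<le> P c v" if "c \<in> K" for c v
    using that \<open>finite K\<close> by (simp add: y_def)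
  \<comment> \<open>The minimizing \<open>c\<close> may vary with \<open>v\<close>; finiteness of
    \<open>K\<close> ensures that there is one.\<close>
  have y_attained: "\<exists>c\<in>K. y v = P c v" for v
  proof -
    have "y v \<in> (\<lambda>c. P c v) ` K"
      unfolding y_def using \<open>finite K\<close> K(1) by (intro Min_in) auto
    then show ?thesis
      by blast
  qed
  have y_nonneg: "0 \<le> y v" if "v \<in> ?V" for v
    using y_attained[of v] P_nonneg that by auto
  \<comment> \<open>Induction along a path from \<open>c\<close>: the reset gives \<open>c\<close>
    mass at least \<open>\<epsilon>\<close>, and each arc passes on a positive share of the mass at
    its tail.\<close>
  have P_pos: "0 < P c v" if "reachable (with_proj G) c v" "c \<in> K" for c v
    using that(1)
  proof (induction rule: reachable_induct)
    case base
    have "0 \<le> (1 - \<epsilon>) * (\<Sum>u\<in>?V. P c u * ?M u c)"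
      using that(2) assms(4) by (auto intro!: mult_nonneg_nonneg sum_nonneg P_nonneg W.M_nonneg)
    then show ?case
      using P_eq[of c c] that(2) K assms(3) by auto
  next
    case (step u v)
    then have arc: "(u, v) \<in> parcs G"
      by auto
    then have uv: "u \<in> ?V" "v \<in> ?V"
      using in_arcsD1 in_arcsD2 by auto
    have "0 < P c u * ?M u v"
      using step.IH arc assms(2)[OF uv(1)] by (simp add: walk_matrix_def)
    also have "\<dots> \<le> (\<Sum>u\<in>?V. P c u * ?M u v)"
      using uv that(2) by (intro member_le_sum) (auto intro!: mult_nonneg_nonneg P_nonneg W.M_nonneg)
    finally have "0 < (1 - \<epsilon>) * (\<Sum>u\<in>?V. P c u * ?M u v)"
      using assms(4) by simp
    then show ?case
      using P_eq[OF that(2) uv(2)] assms(3) by auto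
  qed
  \<comment> \<open>Every vertex of \<open>K\<close> reaches \<open>t\<close>, in particular the one
    attaining the minimum there.\<close>
  have "0 < y t"
    using y_attained[of t] P_pos reach by auto
  then have s_pos: "0 < s"
    unfolding s_def using t y_nonneg by (intro sum_pos2[of ?V t]) auto
  \<comment> \<open>Fix \<open>c\<close> attaining the minimum at \<open>v\<close>. Since
    \<open>y\<close> lies below \<open>P c\<close> everywhere and \<open>M\<close> is nonnegative,
    the inequality for \<open>P c\<close> at \<open>v\<close> carries over to
    \<open>y\<close>.\<close>
  have y_sub: "(1 - \<epsilon>) * (\<Sum>u\<in>?V. y u * ?M u v) \<le> y v" if v: "v \<in> ?V" for v
  proof -
    obtain c where c: "c \<in> K" "y v = P c v"
      using y_attained by blast
    have "(\<Sum>u\<in>?V. y u * ?M u v) \<le> (\<Sum>u\<in>?V. P c u * ?M u v)"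
      by (intro sum_mono mult_right_mono y_le c W.M_nonneg)
    then have "(1 - \<epsilon>) * (\<Sum>u\<in>?V. y u * ?M u v) \<le> (1 - \<epsilon>) * (\<Sum>u\<in>?V. P c u * ?M u v)"
      using assms(4) by simp
    also have "\<dots> \<le> P c v"
      using P_eq[OF c(1) v] assms(3) by auto
    finally show ?thesis
      using c by simp
  qed
  define z where "z = (\<lambda>v\<in>?V. y v / s)"
  \<comment> \<open>As \<open>y\<close> is nonnegative on the vertices, its 1-norm in
    \<open>R_min\<close> is the plain sum \<open>s\<close>.\<close>
  have R_min_eq: "R_min G K \<epsilon> = z"
    using y_nonneg by (simp add: R_min_def z_def s_def y_def P_def Let_def)
  have z_dist: "distribution_on ?V z"
    using y_nonneg s_pos
    by (intro W.distribution_onI)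
      (auto simp: z_def sum_divide_distrib[symmetric] s_def[symmetric])
  have z_sub: "(1 - \<epsilon>) * (\<Sum>u\<in>?V. z u * ?M u v) \<le> z v" if "v \<in> ?V" for v
    using divide_right_mono[OF y_sub[OF that], of s] s_pos that
    by (simp add: z_def sum_divide_distrib[symmetric])
  obtain r where r: "ranking_vector G r"
    "stationary_distribution ?V (\<lambda>u v. (1 - \<epsilon>) * ?M u v + \<epsilon> * reset_matrix r u v) z"
    using W.subinvariant_imp_reset[OF assms(3) z_dist z_sub] by blast
  then have "PR G r \<epsilon> = z"
    using assms(3,4) by (intro PR_eqI stoch)
  with r(1) R_min_eq show ?thesis
    by metis
qed

end
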